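(* Let $(M,\hat g,I_1,I_2,I_3)$ be an HKT-manifold with HKT-connection $D$. Let $\hat\theta$ be a 1-form on $M$ such that $-2\hat\theta$ is a closed potential 1-form for the HKT-manifold and is parallel with respect to $D$. If $V$ is the vector field dual to $\hat\theta$ with respect to $\hat g$ (that is, $\hat\theta=\hat g(V,\cdot)$), then for all $r,s\in\{1,2,3\}$ $$\mathcal L_V\hat g=0,\qquad \mathcal L_{I_rV}\hat g=0,\qquad \mathcal L_{I_rV}I_s=\epsilon^{rst}I_t .$$
   Context: A hypercomplex structure on a smooth manifold $M$ is a triple of integrable complex structures $I_1,I_2,I_3$ with $I_1^2=I_2^2=I_3^2=-\mathrm{Id}$ and $I_1I_2=I_3=-I_2I_1$. With a Riemannian metric $\hat g$ satisfying $\hat g(I_rX,I_rY)=\hat g(X,Y)$ for $r=1,2,3$, $(M,\hat g,I_1,I_2,I_3)$ is called hyperhermitian. The fundamental 2-forms are $\hat F_r(X,Y)=\hat g(I_rX,Y)$. An HKT-connection is a linear connection $D$ with torsion tensor $T^D$ such that $D\hat g=0$, $DI_1=DI_2=DI_3=0$, and $c(X,Y,Z)=\hat g(T^D(X,Y),Z)$ is a 3-form. When it exists it is unique, and $(M,\hat g,I_1,I_2,I_3)$ is then called an HKT-manifold (or HKT-space). For a $k$-form $\omega$: $(I_r\omega)(X_1,\dots,X_k)=(-1)^k\omega(I_rX_1,\dots,I_rX_k)$ and $d_r\omega=(-1)^kI_r\,d\,I_r\omega$. A 1-form $\omega$ is a potential 1-form for the HKT-manifold if, with $\omega_r=I_r\omega$,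 $$\hat F_1=\tfrac12(d\omega_1+d_2\omega_3),\quad \hat F_2=\tfrac12(d\omega_2+d_3\omega_1),\quad \hat F_3=\tfrac12(d\omega_3+d_1\omega_2).$$ It is closed if $d\omega=0$. $\epsilon^{rst}$ is the Levi-Civita symbol on $\{1,2,3\}$, with summation over $t$; $\mathcal L$ denotes the Lie derivative. *)

theory Defs
  imports "HOL-Analysis.Analysis"
begin

section \<open>Smooth manifolds and vector fields\<close>

text \<open>
  \<open>Ck_on k S f\<close> is meant for open sets \<open>S\<close> only: all iterated directional derivatives of \<open>f\<close>
  up to order \<open>k\<close> exist and are continuous on \<open>S\<close>.
\<close>

primrec Ck_on ::
  "nat \<Rightarrow> 'a::euclidean_space set \<Rightarrow> ('a \<Rightarrow> 'b::real_normed_vector) \<Rightarrow> bool" where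
  "Ck_on 0 S f \<longleftrightarrow> continuous_on S f"
| "Ck_on (Suc k) S f \<longleftrightarrow>
     (\<forall>x\<in>S. f differentiable (at x)) \<and> (\<forall>v. Ck_on k S (\<lambda>x. frechet_derivative f (at x) v))"

definition Cinf_on :: "'a::euclidean_space set \<Rightarrow> ('a \<Rightarrow> 'b::real_normed_vector) \<Rightarrow> bool" where
  "Cinf_on S f \<longleftrightarrow> (\<forall>k. Ck_on k S f)"

text \<open>
  A chart is a pair \<open>(U, \<phi>)\<close>. The manifold is the whole (Hausdorff, second countable) type
  \<open>'m\<close>; its dimension is \<open>DIM('e)\<close>. The atlas need not be maximal.
\<close>

type_synonym ('m, 'e) atlas = "('m set \<times> ('m \<Rightarrow> 'e)) set"

definition smooth_atlas ::
  "('m::{t2_space, second_countable_topology}, 'e::euclidean_space) atlas \<Rightarrow> bool" where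
  "smooth_atlas A \<longleftrightarrow>
     (\<Union>(U, \<phi>)\<in>A. U) = UNIV \<and>
     (\<forall>(U, \<phi>)\<in>A. open U \<and> open (\<phi> ` U) \<and> homeomorphism U (\<phi> ` U) \<phi> (inv_into U \<phi>)) \<and>
     (\<forall>(U, \<phi>)\<in>A. \<forall>(W, \<psi>)\<in>A. Cinf_on (\<phi> ` (U \<inter> W)) (\<psi> \<circ> inv_into U \<phi>))"

type_synonym 'm scalar_field = "'m \<Rightarrow> real"

definition smooth_fun ::
  "('m::{t2_space, second_countable_topology}, 'e::euclidean_space) atlas \<Rightarrow>
   'm scalar_field \<Rightarrow> bool" where
  "smooth_fun A f \<longleftrightarrow> (\<forall>(U, \<phi>)\<in>A. Cinf_on (\<phi> ` U) (f \<circ> inv_into U \<phi>))"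

text \<open>
  Tangent vectors at \<open>p\<close> are the derivations at \<open>p\<close> of the algebra of smooth functions. A
  derivation is a function of all of \<open>'m \<Rightarrow> real\<close> here, so its value on non-smooth functions is
  fixed to be \<open>0\<close>; this makes equality of tangent vectors the equality of HOL functions.
\<close>

type_synonym 'm tangent_vector = "'m scalar_field \<Rightarrow> real"
type_synonym 'm vector_field = "'m \<Rightarrow> 'm tangent_vector"

definition tangent_space ::
  "('m::{t2_space, second_countable_topology}, 'e::euclidean_space) atlas \<Rightarrow>
   'm \<Rightarrow> 'm tangent_vector set" where
  "tangent_space A p =
     {v. (\<forall>f. \<not> smooth_fun A f \<longrightarrow> v f = 0) \<and>
         (\<forall>f h. smooth_fun A f \<longrightarrow> smooth_fun A h \<longrightarrow>
            (\<forall>a b. v (\<lambda>x. a * f x + b * h x) = a * v f + b * v h) \<and>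
            v (\<lambda>x. f x * h x) = f p * v h + h p * v f)}"

definition vector_fields ::
  "('m::{t2_space, second_countable_topology}, 'e::euclidean_space) atlas \<Rightarrow>
   'm vector_field set" where
  "vector_fields A =
     {X. (\<forall>p. X p \<in> tangent_space A p) \<and>
         (\<forall>f. smooth_fun A f \<longrightarrow> smooth_fun A (\<lambda>p. X p f))}"

definition vf_apply :: "'m vector_field \<Rightarrow> 'm scalar_field \<Rightarrow> 'm scalar_field" where
  "vf_apply X f = (\<lambda>p. X p f)"

definition vf_add :: "'m vector_field \<Rightarrow> 'm vector_field \<Rightarrow> 'm vector_field" where
  "vf_add X Y = (\<lambda>p f. X p f + Y p f)"

definition vf_diff :: "'m vector_field \<Rightarrow> 'm vector_field \<Rightarrow> 'm vector_field" where
  "vf_diff X Y = (\<lambda>p f. X p f - Y p f)"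

definition vf_scale :: "'m scalar_field \<Rightarrow> 'm vector_field \<Rightarrow> 'm vector_field" where
  "vf_scale h X = (\<lambda>p f. h p * X p f)"

definition vf_zero :: "'m vector_field" where
  "vf_zero = (\<lambda>p f. 0)"

definition lie_bracket :: "'m vector_field \<Rightarrow> 'm vector_field \<Rightarrow> 'm vector_field" where
  "lie_bracket X Y = (\<lambda>p f. X p (vf_apply Y f) - Y p (vf_apply X f))"


section \<open>Tensor fields and differential forms\<close>

text \<open>
  Covariant tensor fields of degree \<open>k\<close> are maps, multilinear over the smooth functions, from
  \<open>k\<close>-tuples of smooth vector fields to smooth functions. A \<open>k\<close>-tuple is a list of length \<open>k\<close>;
  values on other arguments are irrelevant, so equalities of tensor fields are always stated
  on the tuples in \<open>vf_tuples A k\<close>.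
\<close>

type_synonym 'm cov_field = "'m vector_field list \<Rightarrow> 'm scalar_field"
type_synonym 'm endo_field = "'m vector_field \<Rightarrow> 'm vector_field"

definition vf_tuples ::
  "('m::{t2_space, second_countable_topology}, 'e::euclidean_space) atlas \<Rightarrow>
   nat \<Rightarrow> 'm vector_field list set" where
  "vf_tuples A k = {Xs. length Xs = k \<and> set Xs \<subseteq> vector_fields A}"

definition cov_tensor ::
  "('m::{t2_space, second_countable_topology}, 'e::euclidean_space) atlas \<Rightarrow>
   nat \<Rightarrow> 'm cov_field \<Rightarrow> bool" where
  "cov_tensor A k T \<longleftrightarrow>
     (\<forall>Xs\<in>vf_tuples A k. smooth_fun A (T Xs) \<and>
       (\<forall>i<k. \<forall>Y\<in>vector_fields A. \<forall>Z\<in>vector_fields A. \<forall>a b.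
          smooth_fun A a \<longrightarrow> smooth_fun A b \<longrightarrow>
          T (Xs[i := vf_add (vf_scale a Y) (vf_scale b Z)]) =
            (\<lambda>p. a p * T (Xs[i := Y]) p + b p * T (Xs[i := Z]) p)))"

definition diff_form ::
  "('m::{t2_space, second_countable_topology}, 'e::euclidean_space) atlas \<Rightarrow>
   nat \<Rightarrow> 'm cov_field \<Rightarrow> bool" where
  "diff_form A k \<omega> \<longleftrightarrow> cov_tensor A k \<omega> \<and>
     (\<forall>Xs\<in>vf_tuples A k. \<forall>i<k. \<forall>j<k. i \<noteq> j \<longrightarrow> Xs ! i = Xs ! j \<longrightarrow> \<omega> Xs = (\<lambda>p. 0))"

definition endo_tensor ::
  "('m::{t2_space, second_countable_topology}, 'e::euclidean_space) atlas \<Rightarrow>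
   'm endo_field \<Rightarrow> bool" where
  "endo_tensor A J \<longleftrightarrow>
     (\<forall>X\<in>vector_fields A. J X \<in> vector_fields A) \<and>
     (\<forall>X\<in>vector_fields A. \<forall>Y\<in>vector_fields A. \<forall>a b. smooth_fun A a \<longrightarrow> smooth_fun A b \<longrightarrow>
        J (vf_add (vf_scale a X) (vf_scale b Y)) =
          vf_add (vf_scale a (J X)) (vf_scale b (J Y)))"

text \<open>
  Exterior derivative of a \<open>k\<close>-form, by the invariant formula without a factor \<open>1/(k+1)\<close>:
  \<open>d\<omega>(X\<^sub>0, X\<^sub>1) = X\<^sub>0 (\<omega>(X\<^sub>1)) - X\<^sub>1 (\<omega>(X\<^sub>0)) - \<omega>([X\<^sub>0, X\<^sub>1])\<close> for \<open>k = 1\<close>.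
  \<open>nths Xs (- {i})\<close> is \<open>Xs\<close> without its entry at position \<open>i\<close>.
\<close>

definition ext_deriv :: "nat \<Rightarrow> 'm cov_field \<Rightarrow> 'm cov_field" where
  "ext_deriv k \<omega> Xs = (\<lambda>p.
     (\<Sum>i\<le>k. (- 1) ^ i * vf_apply (Xs ! i) (\<omega> (nths Xs (- {i}))) p) +
     (\<Sum>j\<le>k. \<Sum>i<j. (- 1) ^ (i + j) *
        \<omega> (lie_bracket (Xs ! i) (Xs ! j) # nths Xs (- {i, j})) p))"

text \<open>
  The Lie derivative is the tensor derivation which is \<open>X\<close> on functions and \<open>[X, \<cdot>]\<close> on
  vector fields; likewise a connection acts on tensor fields as a tensor derivation.
\<close>

definition lie_cov :: "'m vector_field \<Rightarrow> 'm cov_field \<Rightarrow> 'm cov_field" where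
  "lie_cov X T Ys = (\<lambda>p.
     vf_apply X (T Ys) p - (\<Sum>i<length Ys. T (Ys[i := lie_bracket X (Ys ! i)]) p))"

definition lie_endo :: "'m vector_field \<Rightarrow> 'm endo_field \<Rightarrow> 'm endo_field" where
  "lie_endo X J Y = vf_diff (lie_bracket X (J Y)) (J (lie_bracket X Y))"


section \<open>Linear connections\<close>

type_synonym 'm connection = "'m vector_field \<Rightarrow> 'm vector_field \<Rightarrow> 'm vector_field"

definition linear_connection ::
  "('m::{t2_space, second_countable_topology}, 'e::euclidean_space) atlas \<Rightarrow>
   'm connection \<Rightarrow> bool" where
  "linear_connection A D \<longleftrightarrow>
     (\<forall>X\<in>vector_fields A. \<forall>Y\<in>vector_fields A. \<forall>Z\<in>vector_fields A. \<forall>h. smooth_fun A h \<longrightarrow>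
        D X Y \<in> vector_fields A \<and>
        D (vf_add X Y) Z = vf_add (D X Z) (D Y Z) \<and>
        D (vf_scale h X) Y = vf_scale h (D X Y) \<and>
        D X (vf_add Y Z) = vf_add (D X Y) (D X Z) \<and>
        D X (vf_scale h Y) = vf_add (vf_scale (vf_apply X h) Y) (vf_scale h (D X Y)))"

definition torsion :: "'m connection \<Rightarrow> 'm vector_field \<Rightarrow> 'm vector_field \<Rightarrow> 'm vector_field" where
  "torsion D X Y = vf_diff (vf_diff (D X Y) (D Y X)) (lie_bracket X Y)"

definition nabla_cov :: "'m connection \<Rightarrow> 'm vector_field \<Rightarrow> 'm cov_field \<Rightarrow> 'm cov_field" where
  "nabla_cov D X T Ys = (\<lambda>p.
     vf_apply X (T Ys) p - (\<Sum>i<length Ys. T (Ys[i := D X (Ys ! i)]) p))"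

definition nabla_endo :: "'m connection \<Rightarrow> 'm vector_field \<Rightarrow> 'm endo_field \<Rightarrow> 'm endo_field" where
  "nabla_endo D X J Y = vf_diff (D X (J Y)) (J (D X Y))"

definition parallel_cov ::
  "('m::{t2_space, second_countable_topology}, 'e::euclidean_space) atlas \<Rightarrow>
   'm connection \<Rightarrow> nat \<Rightarrow> 'm cov_field \<Rightarrow> bool" where
  "parallel_cov A D k T \<longleftrightarrow>
     (\<forall>X\<in>vector_fields A. \<forall>Ys\<in>vf_tuples A k. nabla_cov D X T Ys = (\<lambda>p. 0))"

definition parallel_endo ::
  "('m::{t2_space, second_countable_topology}, 'e::euclidean_space) atlas \<Rightarrow>
   'm connection \<Rightarrow> 'm endo_field \<Rightarrow> bool" where
  "parallel_endo A D J \<longleftrightarrow>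
     (\<forall>X\<in>vector_fields A. \<forall>Y\<in>vector_fields A. nabla_endo D X J Y = vf_zero)"


section \<open>Hyperhermitian structures and HKT-manifolds\<close>

definition riemannian_metric ::
  "('m::{t2_space, second_countable_topology}, 'e::euclidean_space) atlas \<Rightarrow>
   'm cov_field \<Rightarrow> bool" where
  "riemannian_metric A g \<longleftrightarrow> cov_tensor A 2 g \<and>
     (\<forall>X\<in>vector_fields A. \<forall>Y\<in>vector_fields A. g [X, Y] = g [Y, X]) \<and>
     (\<forall>X\<in>vector_fields A. \<forall>p. X p \<noteq> (\<lambda>f. 0) \<longrightarrow> g [X, X] p > 0)"

text \<open>Integrability of an almost complex structure is the vanishing of its Nijenhuis tensor.\<close>

definition nijenhuis :: "'m endo_field \<Rightarrow> 'm vector_field \<Rightarrow> 'm vector_field \<Rightarrow> 'm vector_field" where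
  "nijenhuis J X Y =
     vf_diff
       (vf_diff (vf_diff (lie_bracket (J X) (J Y)) (J (lie_bracket (J X) Y)))
         (J (lie_bracket X (J Y))))
       (lie_bracket X Y)"

definition complex_structure ::
  "('m::{t2_space, second_countable_topology}, 'e::euclidean_space) atlas \<Rightarrow>
   'm endo_field \<Rightarrow> bool" where
  "complex_structure A J \<longleftrightarrow> endo_tensor A J \<and>
     (\<forall>X\<in>vector_fields A. J (J X) = vf_diff vf_zero X) \<and>
     (\<forall>X\<in>vector_fields A. \<forall>Y\<in>vector_fields A. nijenhuis J X Y = vf_zero)"

text \<open>Families indexed by \<open>{1, 2, 3}\<close> are functions on \<open>nat\<close> used only at these three arguments.\<close>

definition hypercomplex ::
  "('m::{t2_space, second_countable_topology}, 'e::euclidean_space) atlas \<Rightarrow>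
   (nat \<Rightarrow> 'm endo_field) \<Rightarrow> bool" where
  "hypercomplex A I \<longleftrightarrow>
     (\<forall>r\<in>{1, 2, 3}. complex_structure A (I r)) \<and>
     (\<forall>X\<in>vector_fields A. I 1 (I 2 X) = I 3 X \<and> I 3 X = vf_diff vf_zero (I 2 (I 1 X)))"

definition hyperhermitian ::
  "('m::{t2_space, second_countable_topology}, 'e::euclidean_space) atlas \<Rightarrow>
   'm cov_field \<Rightarrow> (nat \<Rightarrow> 'm endo_field) \<Rightarrow> bool" where
  "hyperhermitian A g I \<longleftrightarrow> riemannian_metric A g \<and> hypercomplex A I \<and>
     (\<forall>r\<in>{1, 2, 3}. \<forall>X\<in>vector_fields A. \<forall>Y\<in>vector_fields A. g [I r X, I r Y] = g [X, Y])"

definition fundamental_form :: "'m cov_field \<Rightarrow> 'm endo_field \<Rightarrow> 'm cov_field" where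
  "fundamental_form g J Xs = g [J (Xs ! 0), Xs ! 1]"

definition torsion_form :: "'m cov_field \<Rightarrow> 'm connection \<Rightarrow> 'm cov_field" where
  "torsion_form g D Xs = g [torsion D (Xs ! 0) (Xs ! 1), Xs ! 2]"

definition hkt_connection ::
  "('m::{t2_space, second_countable_topology}, 'e::euclidean_space) atlas \<Rightarrow>
   'm cov_field \<Rightarrow> (nat \<Rightarrow> 'm endo_field) \<Rightarrow> 'm connection \<Rightarrow> bool" where
  "hkt_connection A g I D \<longleftrightarrow> linear_connection A D \<and> parallel_cov A D 2 g \<and>
     (\<forall>r\<in>{1, 2, 3}. parallel_endo A D (I r)) \<and> diff_form A 3 (torsion_form g D)"

definition hkt_manifold ::
  "('m::{t2_space, second_countable_topology}, 'e::euclidean_space) atlas \<Rightarrow>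
   'm cov_field \<Rightarrow> (nat \<Rightarrow> 'm endo_field) \<Rightarrow> bool" where
  "hkt_manifold A g I \<longleftrightarrow>
     smooth_atlas A \<and> hyperhermitian A g I \<and> (\<exists>D. hkt_connection A g I D)"


section \<open>Potential 1-forms\<close>

text \<open>In the next two definitions \<open>k\<close> is the degree of \<open>\<omega>\<close>.\<close>

definition form_act :: "nat \<Rightarrow> 'm endo_field \<Rightarrow> 'm cov_field \<Rightarrow> 'm cov_field" where
  "form_act k J \<omega> Xs = (\<lambda>p. (- 1) ^ k * \<omega> (map J Xs) p)"

definition twisted_deriv :: "nat \<Rightarrow> 'm endo_field \<Rightarrow> 'm cov_field \<Rightarrow> 'm cov_field" where
  "twisted_deriv k J \<omega> Xs =
     (\<lambda>p. (- 1) ^ k * form_act (Suc k) J (ext_deriv k (form_act k J \<omega>)) Xs p)"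

definition potential_1_form ::
  "('m::{t2_space, second_countable_topology}, 'e::euclidean_space) atlas \<Rightarrow>
   'm cov_field \<Rightarrow> (nat \<Rightarrow> 'm endo_field) \<Rightarrow> 'm cov_field \<Rightarrow> bool" where
  "potential_1_form A g I \<omega> \<longleftrightarrow> diff_form A 1 \<omega> \<and>
     (let \<omega>1 = form_act 1 (I 1) \<omega>; \<omega>2 = form_act 1 (I 2) \<omega>; \<omega>3 = form_act 1 (I 3) \<omega> in
      \<forall>Xs\<in>vf_tuples A 2. \<forall>p.
        fundamental_form g (I 1) Xs p =
          1/2 * (ext_deriv 1 \<omega>1 Xs p + twisted_deriv 1 (I 2) \<omega>3 Xs p) \<and>
        fundamental_form g (I 2) Xs p =
          1/2 * (ext_deriv 1 \<omega>2 Xs p + twisted_deriv 1 (I 3) \<omega>1 Xs p) \<and>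
        fundamental_form g (I 3) Xs p =
          1/2 * (ext_deriv 1 \<omega>3 Xs p + twisted_deriv 1 (I 1) \<omega>2 Xs p))"

definition closed_form ::
  "('m::{t2_space, second_countable_topology}, 'e::euclidean_space) atlas \<Rightarrow>
   nat \<Rightarrow> 'm cov_field \<Rightarrow> bool" where
  "closed_form A k \<omega> \<longleftrightarrow> (\<forall>Xs\<in>vf_tuples A (Suc k). ext_deriv k \<omega> Xs = (\<lambda>p. 0))"

definition levi_civita :: "nat \<Rightarrow> nat \<Rightarrow> nat \<Rightarrow> real" where
  "levi_civita r s t =
     (if (r, s, t) \<in> {(1, 2, 3), (2, 3, 1), (3, 1, 2)} then 1
      else if (r, s, t) \<in> {(1, 3, 2), (3, 2, 1), (2, 1, 3)} then - 1
      else 0)"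

end

theory Submission
  imports Defs
begin

text \<open>
  Since \<open>\<theta>\<close> and all \<open>I\<^sub>r\<close> are parallel, so are \<open>V\<close> and \<open>I\<^sub>r V\<close>. For a parallel field \<open>W\<close> one has
  \<open>[W, X] = D\<^sub>W X - T(W, X)\<close>, so \<open>W\<close> is Killing because the torsion is a 3-form. Closedness
  of \<open>\<theta>\<close> says \<open>T(V, \<cdot>) = 0\<close>, so \<open>\<L>\<^sub>V\<close> also preserves every \<open>I\<^sub>s\<close>, and the vanishing of the Nijenhuis tensor
  of \<open>I\<^sub>r\<close> on \<open>(V, X)\<close> then gives \<open>\<L> I\<^sub>r = 0\<close> along \<open>I\<^sub>r V\<close>. The equation for \<open>F\<^sub>1\<close> in the
  definition of a potential becomes \<open>I\<^sub>1 X = - T(I\<^sub>1 V, X) - I\<^sub>2 T(I\<^sub>1 V, I\<^sub>2 X)\<close>, which is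
  \<open>\<L> I\<^sub>2 = I\<^sub>3\<close> along \<open>I\<^sub>1 V\<close>; the derivative of \<open>I\<^sub>3 = I\<^sub>1 I\<^sub>2\<close> follows by the Leibniz rule, and the
  remaining cases by cyclic permutation.
\<close>

section \<open>The algebra of smooth functions\<close>

text \<open>Since \<open>S\<close> is open, agreement on \<open>S\<close> is agreement near each of
  its points, so all derivatives agree as well. This lets the derivative of a sum or product be
  replaced by its explicit formula.\<close>

lemma Ck_on_cong:
  assumes "open S" "\<And>x. x \<in> S \<Longrightarrow> f x = h x" "Ck_on k S f"
  shows "Ck_on k S h"
  using assms(2,3)
proof (induction k arbitrary: f h)
  case 0
  then show ?case
    using continuous_on_cong[of S S f h] by simp
next
  case (Suc k)
  have der: "(h has_derivative frechet_derivative f (at x)) (at x)" if "x \<in> S" for x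
  proof -
    have "(f has_derivative frechet_derivative f (at x)) (at x)"
      using Suc.prems(2) that frechet_derivative_works by auto
    then show ?thesis
      using has_derivative_transform_within_open \<open>open S\<close> that Suc.prems(1) by blast
  qed
  have "Ck_on k S (\<lambda>x. frechet_derivative h (at x) v)" for v
  proof (rule Suc.IH)
    show "Ck_on k S (\<lambda>x. frechet_derivative f (at x) v)"
      using Suc.prems(2) by simp
    show "frechet_derivative f (at x) v = frechet_derivative h (at x) v" if "x \<in> S" for x
      using frechet_derivative_at[OF der[OF that]] by simp
  qed
  then show ?case
    using der by (auto simp: differentiable_def)
qed

lemma Ck_on_Suc_imp: "Ck_on (Suc k) S f \<Longrightarrow> Ck_on k S f"
proof (induction k arbitrary: f)
  case 0
  then show ?case
    by (auto intro!: continuous_at_imp_continuous_on differentiable_imp_continuous_within)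
next
  case (Suc k)
  show ?case
    unfolding Ck_on.simps(2)[of k]
    using Suc.prems Suc.IH by (simp only: Ck_on.simps(2)[of "Suc k"]) blast
qed

lemma Ck_on_const: "Ck_on k S (\<lambda>x. c)"
  by (induction k arbitrary: c) (auto simp: frechet_derivative_const)

lemma Ck_on_add:
  assumes "open S"
  shows "Ck_on k S f \<Longrightarrow> Ck_on k S h \<Longrightarrow> Ck_on k S (\<lambda>x. f x + h x)"
proof (induction k arbitrary: f h)
  case 0
  then show ?case by (simp add: continuous_on_add)
next
  case (Suc k)
  have der: "((\<lambda>x. f x + h x) has_derivative
      (\<lambda>v. frechet_derivative f (at x) v + frechet_derivative h (at x) v)) (at x)" if "x \<in> S" for x
    using Suc.prems that by (auto intro!: has_derivative_add simp: frechet_derivative_works)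
  have "Ck_on k S (\<lambda>x. frechet_derivative (\<lambda>x. f x + h x) (at x) v)" for v
  proof (rule Ck_on_cong[OF assms])
    show "Ck_on k S (\<lambda>x. frechet_derivative f (at x) v + frechet_derivative h (at x) v)"
      using Suc by auto
  qed (simp add: frechet_derivative_at[OF der, symmetric])
  then show ?case
    using der by (auto simp: differentiable_def)
qed

lemma Ck_on_mult:
  fixes f h :: "'a::euclidean_space \<Rightarrow> 'b::real_normed_algebra"
  assumes "open S"
  shows "Ck_on k S f \<Longrightarrow> Ck_on k S h \<Longrightarrow> Ck_on k S (\<lambda>x. f x * h x)"
proof (induction k arbitrary: f h)
  case 0
  then show ?case by (simp add: continuous_on_mult)
next
  case (Suc k)
  have der: "((\<lambda>x. f x * h x) has_derivative
      (\<lambda>v. f x * frechet_derivative h (at x) v + frechet_derivative f (at x) v * h x)) (at x)"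
    if "x \<in> S" for x
    using Suc.prems that by (auto intro!: has_derivative_mult simp: frechet_derivative_works)
  have "Ck_on k S (\<lambda>x. frechet_derivative (\<lambda>x. f x * h x) (at x) v)" for v
  proof (rule Ck_on_cong[OF assms])
    show "Ck_on k S (\<lambda>x. f x * frechet_derivative h (at x) v + frechet_derivative f (at x) v * h x)"
      \<comment> \<open>The Leibniz formula also contains the undifferentiated factors; these are of
        class \<open>Suc k\<close> and are lowered to class \<open>k\<close> for the induction
        hypothesis.\<close>
      using Suc.prems Suc.prems[THEN Ck_on_Suc_imp] by (intro Ck_on_add[OF assms] Suc.IH) auto
  qed (simp add: frechet_derivative_at[OF der, symmetric])
  then show ?case
    using der by (auto simp: differentiable_def)
qed

lemma smooth_fun_const: "smooth_fun A (\<lambda>p. c)"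
  by (auto simp: smooth_fun_def Cinf_on_def comp_def Ck_on_const)

lemma smooth_fun_add:
  assumes "smooth_atlas A" "smooth_fun A f" "smooth_fun A h"
  shows "smooth_fun A (\<lambda>p. f p + h p)"
  using assms unfolding smooth_fun_def smooth_atlas_def Cinf_on_def comp_def
  by (fastforce intro!: Ck_on_add)

lemma smooth_fun_mult:
  assumes "smooth_atlas A" "smooth_fun A f" "smooth_fun A h"
  shows "smooth_fun A (\<lambda>p. f p * h p)"
  using assms unfolding smooth_fun_def smooth_atlas_def Cinf_on_def comp_def
  by (fastforce intro!: Ck_on_mult)

lemma smooth_fun_lincomb:
  assumes "smooth_atlas A" "smooth_fun A f" "smooth_fun A h"
  shows "smooth_fun A (\<lambda>p. a * f p + b * h p)"
  using assms by (intro smooth_fun_add smooth_fun_mult smooth_fun_const)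


section \<open>Vector fields\<close>

lemma vf_nonsmooth: "X \<in> vector_fields A \<Longrightarrow> \<not> smooth_fun A f \<Longrightarrow> X p f = 0"
  by (auto simp: vector_fields_def tangent_space_def)

lemma vf_smooth: "X \<in> vector_fields A \<Longrightarrow> smooth_fun A f \<Longrightarrow> smooth_fun A (\<lambda>p. X p f)"
  by (auto simp: vector_fields_def)

lemma vf_lincomb:
  "X \<in> vector_fields A \<Longrightarrow> smooth_fun A f \<Longrightarrow> smooth_fun A h \<Longrightarrow>
    X p (\<lambda>x. a * f x + b * h x) = a * X p f + b * X p h"
  by (auto simp: vector_fields_def tangent_space_def)

lemma vf_leibniz:
  "X \<in> vector_fields A \<Longrightarrow> smooth_fun A f \<Longrightarrow> smooth_fun A h \<Longrightarrow>
    X p (\<lambda>x. f x * h x) = f p * X p h + h p * X p f"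
  by (auto simp: vector_fields_def tangent_space_def)

lemma vf_cmult:
  assumes "X \<in> vector_fields A" "smooth_fun A f"
  shows "X p (\<lambda>x. a * f x) = a * X p f"
  using vf_lincomb[OF assms assms(2), of p a 0] by simp

lemma vf_const_zero: "X \<in> vector_fields A \<Longrightarrow> X p (\<lambda>x. 0) = 0"
  using vf_cmult[of X A "\<lambda>_. 0" p 0] smooth_fun_const[of A 0] by simp

lemma vf_zero_in_vector_fields: "vf_zero \<in> vector_fields A"
  by (auto simp: vector_fields_def tangent_space_def vf_zero_def smooth_fun_const)

lemma vf_diff_in_vector_fields:
  assumes "smooth_atlas A" "X \<in> vector_fields A" "Y \<in> vector_fields A"
  shows "vf_diff X Y \<in> vector_fields A"
proof -
  have "smooth_fun A (\<lambda>p. X p f - Y p f)" if "smooth_fun A f" for f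
    using smooth_fun_lincomb[OF assms(1) vf_smooth[OF assms(2) that] vf_smooth[OF assms(3) that],
      of 1 "-1"] by simp
  then show ?thesis
    using assms(2,3)
    by (auto simp: vector_fields_def tangent_space_def vf_diff_def algebra_simps)
qed

lemma vf_add_in_vector_fields:
  assumes "smooth_atlas A" "X \<in> vector_fields A" "Y \<in> vector_fields A"
  shows "vf_add X Y \<in> vector_fields A"
proof -
  have "vf_add X Y = vf_diff X (vf_diff vf_zero Y)"
    by (simp add: vf_add_def vf_diff_def vf_zero_def)
  then show ?thesis
    using assms by (simp add: vf_diff_in_vector_fields vf_zero_in_vector_fields)
qed

lemma lie_bracket_in_vector_fields:
  assumes A: "smooth_atlas A" and X: "X \<in> vector_fields A" and Y: "Y \<in> vector_fields A"
  shows "lie_bracket X Y \<in> vector_fields A"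
proof -
  note sm = vf_smooth[OF X] vf_smooth[OF Y]
  \<comment> \<open>On a non-smooth \<open>f\<close> both fields take the default value 0, so the
    inner functions are constantly 0 and the outer derivations kill them.\<close>
  have "lie_bracket X Y p f = 0" if "\<not> smooth_fun A f" for p f
    using that by (simp add: lie_bracket_def vf_apply_def vf_nonsmooth[OF X] vf_nonsmooth[OF Y]
        vf_const_zero[OF X] vf_const_zero[OF Y])
  moreover have "lie_bracket X Y p (\<lambda>x. a * f x + b * h x) =
      a * lie_bracket X Y p f + b * lie_bracket X Y p h"
    if "smooth_fun A f" "smooth_fun A h" for p f h a b
    using that sm
    by (simp add: lie_bracket_def vf_apply_def vf_lincomb[OF X] vf_lincomb[OF Y] algebra_simps)
  moreover have "lie_bracket X Y p (\<lambda>x. f x * h x) =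
      f p * lie_bracket X Y p h + h p * lie_bracket X Y p f"
    if f: "smooth_fun A f" and h: "smooth_fun A h" for p f h
  proof -
    \<comment> \<open>The mixed products of first derivatives are symmetric in \<open>Z\<close> and
      \<open>W\<close>, so they cancel in the commutator.\<close>
    have *: "Z p (\<lambda>x. f x * W x h + h x * W x f) =
        f p * Z p (\<lambda>x. W x h) + W p h * Z p f + h p * Z p (\<lambda>x. W x f) + W p f * Z p h"
      if Z: "Z \<in> vector_fields A" and W: "W \<in> vector_fields A" for Z W
      using vf_lincomb[OF Z smooth_fun_mult[OF A f vf_smooth[OF W h]]
          smooth_fun_mult[OF A h vf_smooth[OF W f]], of p 1 1]
      by (simp add: vf_leibniz[OF Z f vf_smooth[OF W h]] vf_leibniz[OF Z h vf_smooth[OF W f]])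
    show ?thesis
      by (simp add: lie_bracket_def vf_apply_def vf_leibniz[OF X f h] vf_leibniz[OF Y f h]
          *[OF X Y] *[OF Y X] algebra_simps)
  qed
  moreover have "smooth_fun A (\<lambda>p. lie_bracket X Y p f)" if "smooth_fun A f" for f
    using smooth_fun_lincomb[OF A vf_smooth[OF X vf_smooth[OF Y that]]
        vf_smooth[OF Y vf_smooth[OF X that]], of 1 "-1"]
    by (simp add: lie_bracket_def vf_apply_def)
  ultimately show ?thesis
    by (auto simp: vector_fields_def tangent_space_def)
qed


section \<open>Tensor fields\<close>

lemma vf_tuples_2_iff:
  "Xs \<in> vf_tuples A 2 \<longleftrightarrow> (\<exists>X\<in>vector_fields A. \<exists>Y\<in>vector_fields A. Xs = [X, Y])"
  by (auto simp: vf_tuples_def length_Suc_conv numeral_2_eq_2)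

lemma vf_scale_one: "vf_scale (\<lambda>p. 1) X = X"
  by (simp add: vf_scale_def)

text \<open>Brings differences into the shape of linear combination that \<open>cov_tensor\<close>
  and \<open>endo_tensor\<close> speak about.\<close>

lemma vf_diff_eq_add_scale:
  "vf_diff X Y = vf_add (vf_scale (\<lambda>p. 1) X) (vf_scale (\<lambda>p. - 1) Y)"
  by (simp add: vf_diff_def vf_add_def vf_scale_def)

lemma cov_tensor_smooth: "cov_tensor A k T \<Longrightarrow> Xs \<in> vf_tuples A k \<Longrightarrow> smooth_fun A (T Xs)"
  by (simp add: cov_tensor_def)

lemma cov_tensor_lincomb:
  assumes "cov_tensor A k T" "Xs \<in> vf_tuples A k" "i < k"
    "Y \<in> vector_fields A" "Z \<in> vector_fields A" "smooth_fun A a" "smooth_fun A b"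
  shows "T (Xs[i := vf_add (vf_scale a Y) (vf_scale b Z)]) p =
    a p * T (Xs[i := Y]) p + b p * T (Xs[i := Z]) p"
  using assms by (simp add: cov_tensor_def)

lemma cov_tensor_add:
  assumes "cov_tensor A k T" "Xs \<in> vf_tuples A k" "i < k"
    "Y \<in> vector_fields A" "Z \<in> vector_fields A"
  shows "T (Xs[i := vf_add Y Z]) p = T (Xs[i := Y]) p + T (Xs[i := Z]) p"
  using cov_tensor_lincomb[OF assms smooth_fun_const[of A 1] smooth_fun_const[of A 1]]
  by (simp add: vf_scale_one)

lemma cov_tensor_diff:
  assumes "cov_tensor A k T" "Xs \<in> vf_tuples A k" "i < k"
    "Y \<in> vector_fields A" "Z \<in> vector_fields A"
  shows "T (Xs[i := vf_diff Y Z]) p = T (Xs[i := Y]) p - T (Xs[i := Z]) p"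
  using cov_tensor_lincomb[OF assms smooth_fun_const[of A 1] smooth_fun_const[of A "-1"]]
  by (simp add: vf_diff_eq_add_scale)

text \<open>Polarization: \<open>diff_form\<close> only demands vanishing on repeated entries, and
  expanding the vanishing value with \<open>Y + Z\<close> in both slots gives antisymmetry.\<close>

lemma diff_form_swap:
  assumes A: "smooth_atlas A" and w: "diff_form A k \<omega>" and Xs: "Xs \<in> vf_tuples A k"
    and i: "i < k" and j: "j < k" and ij: "i \<noteq> j"
    and Y: "Y \<in> vector_fields A" and Z: "Z \<in> vector_fields A"
  shows "\<omega> (Xs[i := Y, j := Z]) p = - \<omega> (Xs[i := Z, j := Y]) p"
proof -
  have c: "cov_tensor A k \<omega>" using w by (simp add: diff_form_def)
  have up: "Xs'[l := U] \<in> vf_tuples A k"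
    if "Xs' \<in> vf_tuples A k" "U \<in> vector_fields A" for Xs' l U
    using that by (auto simp: vf_tuples_def dest!: subsetD[OF set_update_subset_insert])
  have alt: "\<omega> (Xs[i := U, j := U]) p = 0" if "U \<in> vector_fields A" for U
  proof -
    have "Xs[i := U, j := U] \<in> vf_tuples A k" using up Xs that by blast
    moreover have "Xs[i := U, j := U] ! i = Xs[i := U, j := U] ! j"
      using i j ij Xs by (simp add: vf_tuples_def)
    ultimately show ?thesis using w i j ij unfolding diff_form_def by metis
  qed
  let ?S = "vf_add Y Z"
  have S: "?S \<in> vector_fields A" using vf_add_in_vector_fields[OF A Y Z] .
  have add_i: "\<omega> (Xs[i := ?S, j := U]) p = \<omega> (Xs[i := Y, j := U]) p + \<omega> (Xs[i := Z, j := U]) p"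
    if "U \<in> vector_fields A" for U
    using cov_tensor_add[OF c up[OF Xs that, of j] i Y Z] ij by (simp add: list_update_swap)
  have "0 = \<omega> (Xs[i := ?S, j := ?S]) p"
    using alt[OF S] by simp
  also have "\<dots> = \<omega> (Xs[i := ?S, j := Y]) p + \<omega> (Xs[i := ?S, j := Z]) p"
    using cov_tensor_add[OF c up[OF Xs S, of i] j Y Z] .
  also have "\<dots> = \<omega> (Xs[i := Z, j := Y]) p + \<omega> (Xs[i := Y, j := Z]) p"
    using alt[OF Y] alt[OF Z] add_i[OF Y] add_i[OF Z] by simp
  finally show ?thesis by simp
qed

lemma endo_tensor_in: "endo_tensor A J \<Longrightarrow> X \<in> vector_fields A \<Longrightarrow> J X \<in> vector_fields A"
  by (simp add: endo_tensor_def)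

lemma endo_tensor_diff:
  assumes "endo_tensor A J" "X \<in> vector_fields A" "Y \<in> vector_fields A"
  shows "J (vf_diff X Y) = vf_diff (J X) (J Y)"
  using assms smooth_fun_const[of A 1] smooth_fun_const[of A "-1"]
  unfolding vf_diff_eq_add_scale endo_tensor_def by blast

lemma endo_tensor_zero:
  assumes "endo_tensor A J"
  shows "J vf_zero = vf_zero"
  using endo_tensor_diff[OF assms vf_zero_in_vector_fields vf_zero_in_vector_fields]
  by (simp add: vf_diff_def vf_zero_def)

lemma complex_structureD:
  assumes "complex_structure A J"
  shows "endo_tensor A J" "X \<in> vector_fields A \<Longrightarrow> J (J X) = vf_diff vf_zero X"
  using assms by (auto simp: complex_structure_def)

lemma cov_tensor_form_act:
  assumes "smooth_atlas A" and w: "cov_tensor A 1 \<omega>" and J: "endo_tensor A J"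
  shows "cov_tensor A 1 (form_act 1 J \<omega>)"
proof -
  have "smooth_fun A (\<lambda>p. - \<omega> [J X] p)" if "X \<in> vector_fields A" for X
    using smooth_fun_mult[OF assms(1) smooth_fun_const[of A "-1"] cov_tensor_smooth[OF w]]
      endo_tensor_in[OF J that] by (simp add: vf_tuples_def)
  moreover have "\<omega> [J (vf_add (vf_scale a Y) (vf_scale b Z))] p = a p * \<omega> [J Y] p + b p * \<omega> [J Z] p"
    if "Y \<in> vector_fields A" "Z \<in> vector_fields A" "smooth_fun A a" "smooth_fun A b" for Y Z a b p
    using cov_tensor_lincomb[OF w, of "[J Y]" 0 "J Y" "J Z" a b p] that J
    by (simp add: vf_tuples_def endo_tensor_def)
  ultimately show ?thesis
    by (auto simp: cov_tensor_def form_act_def vf_tuples_def length_Suc_conv algebra_simps)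
qed

lemma ext_deriv_1:
  "ext_deriv 1 \<omega> [X, Y] p = X p (\<omega> [Y]) - Y p (\<omega> [X]) - \<omega> [lie_bracket X Y] p"
proof -
  have "nths [X, Y] (- {0}) = [Y]" "nths [X, Y] (- {Suc 0}) = [X]" "nths [X, Y] (- {0, Suc 0}) = []"
    by (simp_all add: nths_Cons)
  then show ?thesis
    by (simp add: ext_deriv_def vf_apply_def)
qed


section \<open>Parallel tensor fields\<close>

lemma connection_in_vector_fields:
  assumes "linear_connection A D" "X \<in> vector_fields A" "Y \<in> vector_fields A"
  shows "D X Y \<in> vector_fields A"
  using assms smooth_fun_const[of A 0] unfolding linear_connection_def by blast

lemma torsion_in_vector_fields:
  assumes "smooth_atlas A" "linear_connection A D" "X \<in> vector_fields A" "Y \<in> vector_fields A"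
  shows "torsion D X Y \<in> vector_fields A"
  using assms connection_in_vector_fields[OF assms(2)] unfolding torsion_def
  by (simp add: vf_diff_in_vector_fields lie_bracket_in_vector_fields)

lemma parallel_cov_1:
  assumes "parallel_cov A D 1 \<omega>" "X \<in> vector_fields A" "Y \<in> vector_fields A"
  shows "X p (\<omega> [Y]) = \<omega> [D X Y] p"
proof -
  have "nabla_cov D X \<omega> [Y] p = 0"
    using assms by (simp add: parallel_cov_def vf_tuples_def)
  then show ?thesis by (simp add: nabla_cov_def vf_apply_def)
qed

lemma parallel_endoD:
  assumes "parallel_endo A D J" "X \<in> vector_fields A" "Y \<in> vector_fields A"
  shows "D X (J Y) = J (D X Y)"
proof -
  have "nabla_endo D X J Y = vf_zero" using assms by (simp add: parallel_endo_def)
  then show ?thesis by (simp add: nabla_endo_def vf_diff_def vf_zero_def fun_eq_iff)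
qed

lemma parallel_cov_form_act:
  assumes w: "cov_tensor A 1 \<omega>" "parallel_cov A D 1 \<omega>"
    and J: "endo_tensor A J" "parallel_endo A D J"
  shows "parallel_cov A D 1 (form_act 1 J \<omega>)"
proof -
  have "X p (\<lambda>q. - \<omega> [J Y] q) = - \<omega> [J (D X Y)] p"
    if X: "X \<in> vector_fields A" and Y: "Y \<in> vector_fields A" for X Y p
  proof -
    have "smooth_fun A (\<omega> [J Y])"
      using cov_tensor_smooth[OF w(1)] endo_tensor_in[OF J(1) Y] by (simp add: vf_tuples_def)
    then have "X p (\<lambda>q. - \<omega> [J Y] q) = - X p (\<omega> [J Y])"
      using vf_cmult[OF X, of "\<omega> [J Y]" p "-1"] by simp
    then show ?thesis
      using parallel_cov_1[OF w(2) X endo_tensor_in[OF J(1) Y]] parallel_endoD[OF J(2) X Y] by simp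
  qed
  then show ?thesis
    by (auto simp: parallel_cov_def nabla_cov_def form_act_def vf_apply_def vf_tuples_def
        length_Suc_conv fun_eq_iff)
qed

text \<open>Parallelism turns \<open>X (\<omega> Y)\<close> into \<open>\<omega> (D X Y)\<close>,
  and the three terms of the exterior derivative collect to \<open>\<omega>\<close> of
  \<open>D X Y - D Y X - [X, Y]\<close>. Differential conditions on parallel forms thus become
  algebraic conditions on the torsion.\<close>

lemma ext_deriv_parallel:
  assumes "smooth_atlas A" "linear_connection A D" "cov_tensor A 1 \<omega>" "parallel_cov A D 1 \<omega>"
    and X: "X \<in> vector_fields A" and Y: "Y \<in> vector_fields A"
  shows "ext_deriv 1 \<omega> [X, Y] p = \<omega> [torsion D X Y] p"
proof -
  have diff: "\<omega> [vf_diff U W] p = \<omega> [U] p - \<omega> [W] p"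
    if "U \<in> vector_fields A" "W \<in> vector_fields A" for U W
    using cov_tensor_diff[OF assms(3), of "[U]" 0 U W] that by (simp add: vf_tuples_def)
  have "D X Y \<in> vector_fields A" "D Y X \<in> vector_fields A" "lie_bracket X Y \<in> vector_fields A"
    using assms connection_in_vector_fields lie_bracket_in_vector_fields by blast+
  then show ?thesis
    by (simp add: ext_deriv_1 torsion_def diff vf_diff_in_vector_fields[OF assms(1)]
        parallel_cov_1[OF assms(4) X Y] parallel_cov_1[OF assms(4) Y X] del: One_nat_def)
qed


section \<open>Metric connections with skew torsion\<close>

locale skew_torsion_connection =
  fixes A :: "('m::{t2_space, second_countable_topology}, 'e::euclidean_space) atlas"
    and g :: "'m cov_field" and D :: "'m connection"
  assumes atlas: "smooth_atlas A"
    and metric: "riemannian_metric A g"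
    and connection: "linear_connection A D"
    and parallel_metric: "parallel_cov A D 2 g"
    and skew_torsion: "diff_form A 3 (torsion_form g D)"
begin

lemmas diff_in = vf_diff_in_vector_fields[OF atlas]
  and D_in = connection_in_vector_fields[OF connection]
  and torsion_in = torsion_in_vector_fields[OF atlas connection]

lemma metric_tensor: "cov_tensor A 2 g"
  using metric by (simp add: riemannian_metric_def)

lemma metric_sym: "X \<in> vector_fields A \<Longrightarrow> Y \<in> vector_fields A \<Longrightarrow> g [X, Y] = g [Y, X]"
  using metric by (simp add: riemannian_metric_def)

lemma metric_diff_left:
  assumes "X \<in> vector_fields A" "Y \<in> vector_fields A" "Z \<in> vector_fields A"
  shows "g [vf_diff X Y, Z] p = g [X, Z] p - g [Y, Z] p"
  using cov_tensor_diff[OF metric_tensor, of "[X, Z]" 0 X Y] assms by (simp add: vf_tuples_def)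

lemma metric_diff_right:
  assumes "X \<in> vector_fields A" "Y \<in> vector_fields A" "Z \<in> vector_fields A"
  shows "g [Z, vf_diff X Y] p = g [Z, X] p - g [Z, Y] p"
  using metric_diff_left[OF assms] metric_sym assms diff_in by simp

lemma metric_zero_left: "X \<in> vector_fields A \<Longrightarrow> g [vf_zero, X] p = 0"
  using metric_diff_left[OF vf_zero_in_vector_fields vf_zero_in_vector_fields, of X p]
  by (simp add: vf_diff_def vf_zero_def)

text \<open>Testing with \<open>Z = X - Y\<close>, positive definiteness forces the difference to
  vanish at every point.\<close>

lemma metric_nondegenerate:
  assumes X: "X \<in> vector_fields A" and Y: "Y \<in> vector_fields A"
    and eq: "\<And>Z p. Z \<in> vector_fields A \<Longrightarrow> g [X, Z] p = g [Y, Z] p"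
  shows "X = Y"
proof -
  have "vf_diff X Y p = (\<lambda>f. 0)" for p
  proof -
    have "g [vf_diff X Y, vf_diff X Y] p = 0"
      using metric_diff_left[OF X Y diff_in[OF X Y]] eq[OF diff_in[OF X Y]] by simp
    then show ?thesis
      using metric diff_in[OF X Y] unfolding riemannian_metric_def by (metis less_irrefl)
  qed
  then show ?thesis by (simp add: vf_diff_def fun_eq_iff)
qed

text \<open>Write \<open>X = H (H (- X))\<close> and remove the outer \<open>H\<close> from both
  arguments by isometry.\<close>

lemma isometry_skew:
  assumes H: "complex_structure A H"
    and iso: "\<And>X Y. X \<in> vector_fields A \<Longrightarrow> Y \<in> vector_fields A \<Longrightarrow> g [H X, H Y] = g [X, Y]"
    and X: "X \<in> vector_fields A" and Y: "Y \<in> vector_fields A"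
  shows "g [X, H Y] p = - g [H X, Y] p"
proof -
  note HX = endo_tensor_in[OF complex_structureD(1)[OF H] X]
  have "g [X, H Y] p = g [H (H (vf_diff vf_zero X)), H Y] p"
    using complex_structureD(2)[OF H diff_in[OF vf_zero_in_vector_fields X]]
    by (simp add: vf_diff_def vf_zero_def)
  also have "\<dots> = g [vf_diff vf_zero (H X), Y] p"
    using endo_tensor_diff[OF complex_structureD(1)[OF H] vf_zero_in_vector_fields X]
      iso[OF diff_in[OF vf_zero_in_vector_fields HX] Y] endo_tensor_zero[OF complex_structureD(1)[OF H]]
    by simp
  also have "\<dots> = - g [H X, Y] p"
    using metric_diff_left[OF vf_zero_in_vector_fields HX Y] metric_zero_left[OF Y] by simp
  finally show ?thesis .
qed

lemma metric_parallel:
  assumes "X \<in> vector_fields A" "Y \<in> vector_fields A" "Z \<in> vector_fields A"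
  shows "X p (g [Y, Z]) = g [D X Y, Z] p + g [Y, D X Z] p"
proof -
  have "nabla_cov D X g [Y, Z] p = 0"
    using parallel_metric assms by (simp add: parallel_cov_def vf_tuples_def)
  then show ?thesis by (simp add: nabla_cov_def vf_apply_def)
qed

text \<open>Differentiating \<open>g [V, Z]\<close> along \<open>X\<close> by parallelism of
  \<open>\<omega>\<close> and by parallelism of \<open>g\<close> gives results that differ by
  \<open>g [D X V, Z]\<close>, which must therefore vanish for all \<open>Z\<close>.\<close>

lemma dual_of_parallel:
  assumes "parallel_cov A D 1 \<omega>" and V: "V \<in> vector_fields A" and c: "c \<noteq> 0"
    and dual: "\<And>X p. X \<in> vector_fields A \<Longrightarrow> \<omega> [X] p = c * g [V, X] p"
    and X: "X \<in> vector_fields A"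
  shows "D X V = vf_zero"
proof (rule metric_nondegenerate[OF D_in[OF X V] vf_zero_in_vector_fields])
  fix Z p assume Z: "Z \<in> vector_fields A"
  have "smooth_fun A (g [V, Z])"
    using cov_tensor_smooth[OF metric_tensor] V Z by (simp add: vf_tuples_def)
  moreover have "\<omega> [Z] = (\<lambda>p. c * g [V, Z] p)"
    using dual[OF Z] by auto
  ultimately have "X p (\<omega> [Z]) = c * X p (g [V, Z])"
    using vf_cmult[OF X] by metis
  then have "X p (g [V, Z]) = g [V, D X Z] p"
    using parallel_cov_1[OF assms(1) X Z] dual[OF D_in[OF X Z]] c by simp
  then show "g [D X V, Z] p = g [vf_zero, Z] p"
    using metric_parallel[OF X V Z] metric_zero_left[OF Z] by simp
qed

section \<open>Symmetries of the torsion 3-form\<close>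

lemma torsion_swap: "torsion D X Y p f = - torsion D Y X p f"
  by (simp add: torsion_def vf_diff_def lie_bracket_def)

lemma torsion_skew_right:
  assumes "X \<in> vector_fields A" "Y \<in> vector_fields A" "Z \<in> vector_fields A"
  shows "g [torsion D X Y, Z] p = - g [torsion D X Z, Y] p"
  \<comment> \<open>Entries 1 and 2 of \<open>[X, X, X]\<close> are placeholders that the updates
    overwrite.\<close>
  using diff_form_swap[OF atlas skew_torsion, of "[X, X, X]" 1 2 Y Z p] assms
  by (simp add: vf_tuples_def torsion_form_def)

lemma torsion_skew_left:
  assumes "X \<in> vector_fields A" "Y \<in> vector_fields A" "Z \<in> vector_fields A"
  shows "g [torsion D X Y, Z] p = - g [torsion D Y X, Z] p"
proof -
  have "torsion D X Y = vf_diff vf_zero (torsion D Y X)"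
    by (intro ext) (simp add: torsion_swap[of X Y] vf_diff_def vf_zero_def)
  then show ?thesis
    using metric_diff_left[OF vf_zero_in_vector_fields torsion_in[OF assms(2,1)] assms(3)]
      metric_zero_left[OF assms(3)] by simp
qed

text \<open>Serves to carry a fixed field such as \<open>V\<close> or \<open>J V\<close> from the
  last slot into the first argument of the torsion.\<close>

lemma torsion_cyclic:
  assumes "X \<in> vector_fields A" "Y \<in> vector_fields A" "Z \<in> vector_fields A"
  shows "g [torsion D X Y, Z] p = g [torsion D Z X, Y] p"
  using torsion_skew_right[OF assms] torsion_skew_left[OF assms(1,3,2)] by simp

section \<open>Lie derivatives along parallel vector fields\<close>

lemma bracket_parallel:
  assumes "D X W = vf_zero"
  shows "lie_bracket W X = vf_diff (D W X) (torsion D W X)"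
  using assms by (simp add: torsion_def vf_diff_def vf_zero_def)

text \<open>In \<open>g [[W, X], Y] + g [X, [W, Y]]\<close> the \<open>D W\<close> terms add up to
  \<open>W (g [X, Y])\<close> because \<open>g\<close> is parallel, and the torsion terms cancel by
  skewness.\<close>

lemma parallel_imp_killing:
  assumes W: "W \<in> vector_fields A" and par: "\<And>X. X \<in> vector_fields A \<Longrightarrow> D X W = vf_zero"
    and Xs: "Xs \<in> vf_tuples A 2"
  shows "lie_cov W g Xs = (\<lambda>p. 0)"
proof -
  obtain X Y where X: "X \<in> vector_fields A" and Y: "Y \<in> vector_fields A" and Xs: "Xs = [X, Y]"
    using Xs vf_tuples_2_iff by blast
  have "g [lie_bracket W X, Y] p + g [X, lie_bracket W Y] p = W p (g [X, Y])" for p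
    using torsion_skew_right[OF W X Y, of p] metric_sym[OF X torsion_in[OF W Y]]
      metric_diff_left[OF D_in[OF W X] torsion_in[OF W X] Y, of p]
      metric_diff_right[OF D_in[OF W Y] torsion_in[OF W Y] X, of p]
    by (simp add: bracket_parallel[OF par] X Y metric_parallel[OF W X Y])
  then show ?thesis
    by (simp add: Xs lie_cov_def vf_apply_def)
qed

text \<open>The \<open>D W\<close> terms cancel because \<open>J\<close> is parallel; what remains
  is the commutator of \<open>J\<close> with the torsion endomorphism of \<open>W\<close>.\<close>

lemma lie_endo_parallel:
  assumes W: "W \<in> vector_fields A" and par: "\<And>X. X \<in> vector_fields A \<Longrightarrow> D X W = vf_zero"
    and J: "endo_tensor A J" "parallel_endo A D J" and X: "X \<in> vector_fields A"
  shows "lie_endo W J X = vf_diff (J (torsion D W X)) (torsion D W (J X))"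
  using endo_tensor_diff[OF J(1) D_in[OF W X] torsion_in[OF W X]] parallel_endoD[OF J(2) W X]
  by (simp add: lie_endo_def bracket_parallel par X endo_tensor_in[OF J(1) X] vf_diff_def fun_eq_iff)

text \<open>Here \<open>0 = d\<omega>(X, Z) = \<omega>(T(X, Z)) = c g(V, T(X, Z)) = c g(T(V, X),
  Z)\<close>, the last equality by cyclic symmetry.\<close>

lemma torsion_dual_of_closed:
  assumes w: "cov_tensor A 1 \<omega>" "parallel_cov A D 1 \<omega>" "closed_form A 1 \<omega>"
    and V: "V \<in> vector_fields A" and c: "c \<noteq> 0"
    and dual: "\<And>X p. X \<in> vector_fields A \<Longrightarrow> \<omega> [X] p = c * g [V, X] p"
    and X: "X \<in> vector_fields A"
  shows "torsion D V X = vf_zero"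
proof (rule metric_nondegenerate[OF torsion_in[OF V X] vf_zero_in_vector_fields])
  fix Z p assume Z: "Z \<in> vector_fields A"
  have "ext_deriv 1 \<omega> [X, Z] = (\<lambda>p. 0)"
    using w(3) X Z by (simp add: closed_form_def vf_tuples_def)
  then have "\<omega> [torsion D X Z] p = 0"
    using ext_deriv_parallel[OF atlas connection w(1,2) X Z, of p] by simp
  then have "g [torsion D X Z, V] p = 0"
    using dual[OF torsion_in[OF X Z]] metric_sym[OF V torsion_in[OF X Z]] c by simp
  then show "g [torsion D V X, Z] p = g [vf_zero, Z] p"
    using torsion_cyclic[OF X Z V, of p] metric_zero_left[OF Z] by simp
qed

end


section \<open>Lie derivatives of the complex structures\<close>

text \<open>Once \<open>J (J Y) = - Y\<close> is used on \<open>Y = [V, X]\<close>, the Nijenhuis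
  tensor on \<open>(V, X)\<close> is exactly the difference of the two sides.\<close>

lemma lie_endo_along_image:
  assumes A: "smooth_atlas A" and J: "complex_structure A J"
    and V: "V \<in> vector_fields A" and X: "X \<in> vector_fields A"
  shows "lie_endo (J V) J X = J (lie_endo V J X)"
proof -
  note J_in = endo_tensor_in[OF complex_structureD(1)[OF J]]
  note br = lie_bracket_in_vector_fields[OF A]
  have "nijenhuis J V X = vf_zero"
    using J V X by (simp add: complex_structure_def)
  then have "nijenhuis J V X p f = 0" for p f
    by (simp add: vf_zero_def)
  then have "lie_bracket (J V) (J X) p f - J (lie_bracket (J V) X) p f =
      J (lie_bracket V (J X)) p f + lie_bracket V X p f" for p f
    by (simp add: nijenhuis_def vf_diff_def algebra_simps)
  moreover have "J (lie_endo V J X) = vf_diff (J (lie_bracket V (J X))) (vf_diff vf_zero (lie_bracket V X))"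
    using endo_tensor_diff[OF complex_structureD(1)[OF J] br[OF V J_in[OF X]] J_in[OF br[OF V X]]]
      complex_structureD(2)[OF J br[OF V X]]
    by (simp add: lie_endo_def)
  ultimately show ?thesis
    by (intro ext) (simp add: lie_endo_def vf_diff_def vf_zero_def)
qed

text \<open>Leibniz rule for a composition: the two terms \<open>J [W, K X]\<close> on the right
  cancel.\<close>

lemma lie_endo_comp:
  assumes A: "smooth_atlas A" and J: "endo_tensor A J" and K: "endo_tensor A K"
    and L: "\<And>X. X \<in> vector_fields A \<Longrightarrow> L X = J (K X)"
    and W: "W \<in> vector_fields A" and X: "X \<in> vector_fields A"
  shows "lie_endo W L X = vf_add (lie_endo W J (K X)) (J (lie_endo W K X))"
  using endo_tensor_diff[OF J lie_bracket_in_vector_fields[OF A W endo_tensor_in[OF K X]]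
      endo_tensor_in[OF K lie_bracket_in_vector_fields[OF A W X]]]
    L[OF X] L[OF lie_bracket_in_vector_fields[OF A W X]]
  by (simp add: lie_endo_def vf_add_def vf_diff_def)

text \<open>
  \<open>(J, K, L)\<close> stands for a cyclic permutation of \<open>(I 1, I 2, I 3)\<close>, and the assumption
  \<open>potential\<close> for the corresponding equation in the definition of a potential 1-form.
\<close>

locale potential_triple = skew_torsion_connection A g D
  for A :: "('m::{t2_space, second_countable_topology}, 'e::euclidean_space) atlas"
    and g :: "'m cov_field" and D :: "'m connection" +
  fixes J K L :: "'m endo_field" and \<omega> :: "'m cov_field" and V :: "'m vector_field"
  assumes complex: "complex_structure A J" "complex_structure A K" "complex_structure A L"
    and JK: "\<And>X. X \<in> vector_fields A \<Longrightarrow> J (K X) = L X"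
    and LK: "\<And>X. X \<in> vector_fields A \<Longrightarrow> L (K X) = vf_diff vf_zero (J X)"
    and JL: "\<And>X. X \<in> vector_fields A \<Longrightarrow> J (L X) = vf_diff vf_zero (K X)"
    and KJ: "\<And>X. X \<in> vector_fields A \<Longrightarrow> K (J X) = vf_diff vf_zero (L X)"
    and J_isometry: "\<And>X Y. X \<in> vector_fields A \<Longrightarrow> Y \<in> vector_fields A \<Longrightarrow> g [J X, J Y] = g [X, Y]"
    and K_isometry: "\<And>X Y. X \<in> vector_fields A \<Longrightarrow> Y \<in> vector_fields A \<Longrightarrow> g [K X, K Y] = g [X, Y]"
    and par: "parallel_endo A D J" "parallel_endo A D K" "parallel_endo A D L"
    and form: "cov_tensor A 1 \<omega>" "parallel_cov A D 1 \<omega>"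
    and potential: "\<And>Xs p. Xs \<in> vf_tuples A 2 \<Longrightarrow> fundamental_form g J Xs p =
          1/2 * (ext_deriv 1 (form_act 1 J \<omega>) Xs p + twisted_deriv 1 K (form_act 1 L \<omega>) Xs p)"
    and V_in: "V \<in> vector_fields A"
    and V_parallel: "\<And>X. X \<in> vector_fields A \<Longrightarrow> D X V = vf_zero"
    and V_torsion: "\<And>X. X \<in> vector_fields A \<Longrightarrow> torsion D V X = vf_zero"
    and dual: "\<And>X p. X \<in> vector_fields A \<Longrightarrow> \<omega> [X] p = - 2 * g [V, X] p"
begin

lemmas endo = complex(1)[THEN complex_structureD(1)] complex(2)[THEN complex_structureD(1)]
    complex(3)[THEN complex_structureD(1)]
  and J_in = complex(1)[THEN complex_structureD(1), THEN endo_tensor_in]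
  and K_in = complex(2)[THEN complex_structureD(1), THEN endo_tensor_in]
  and L_in = complex(3)[THEN complex_structureD(1), THEN endo_tensor_in]

lemma JV_parallel: "X \<in> vector_fields A \<Longrightarrow> D X (J V) = vf_zero"
  using parallel_endoD[OF par(1) _ V_in] V_parallel endo_tensor_zero[OF endo(1)] by simp

text \<open>The equation \<open>potential\<close> with both exterior derivatives evaluated on the
  torsion, which is possible because they are taken of the parallel forms \<open>J \<omega>\<close>
  and \<open>K L \<omega>\<close>. The factor 2 from \<open>dual\<close> absorbs the
  \<open>1/2\<close>.\<close>

lemma potential_torsion:
  assumes X: "X \<in> vector_fields A" and Y: "Y \<in> vector_fields A"
  shows "g [J X, Y] p = g [torsion D (J V) (K X), K Y] p - g [torsion D (J V) X, Y] p"
proof -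
  have T: "torsion D X Y \<in> vector_fields A" "torsion D (K X) (K Y) \<in> vector_fields A"
    using X Y by (auto intro: torsion_in K_in)
  \<comment> \<open>The sign of \<open>-2\<close> in \<open>dual\<close> is reversed by moving
    \<open>J\<close> from \<open>U\<close> to \<open>V\<close>.\<close>
  have dw: "\<omega> [J U] p = 2 * g [U, J V] p" if "U \<in> vector_fields A" for U
    using dual[OF J_in[OF that]] isometry_skew[OF complex(1) J_isometry V_in that]
      metric_sym[OF that J_in[OF V_in]] by simp
  have "ext_deriv 1 (form_act 1 J \<omega>) [X, Y] p = - \<omega> [J (torsion D X Y)] p"
    using ext_deriv_parallel[OF atlas connection cov_tensor_form_act[OF atlas form(1) endo(1)]
        parallel_cov_form_act[OF form endo(1) par(1)] X Y, of p]
    by (simp add: form_act_def)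
  then have 1: "ext_deriv 1 (form_act 1 J \<omega>) [X, Y] p = - 2 * g [torsion D (J V) X, Y] p"
    using dw[OF T(1)] torsion_cyclic[OF X Y J_in[OF V_in]] by simp
  have "ext_deriv 1 (form_act 1 K (form_act 1 L \<omega>)) [K X, K Y] p
      = \<omega> [L (K (torsion D (K X) (K Y)))] p"
    using ext_deriv_parallel[OF atlas connection
        cov_tensor_form_act[OF atlas cov_tensor_form_act[OF atlas form(1) endo(3)] endo(2)]
        parallel_cov_form_act[OF cov_tensor_form_act[OF atlas form(1) endo(3)]
          parallel_cov_form_act[OF form endo(3) par(3)] endo(2) par(2)] K_in[OF X] K_in[OF Y], of p]
    by (simp add: form_act_def)
  \<comment> \<open>By \<open>L K = - J\<close> the second derivative involves the same expression
    \<open>\<omega> [J U]\<close> as the first.\<close>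
  also have "\<dots> = \<omega> [vf_diff vf_zero (J (torsion D (K X) (K Y)))] p"
    using LK[OF T(2)] by simp
  also have "\<dots> = - \<omega> [J (torsion D (K X) (K Y))] p"
    \<comment> \<open>The list \<open>[V]\<close> is a placeholder whose only entry is overwritten.
      The second instance, with \<open>0 - 0\<close>, yields
      \<open>\<omega> [vf_zero] p = 0\<close>.\<close>
    using cov_tensor_diff[OF form(1), of "[V]" 0 vf_zero "J (torsion D (K X) (K Y))" p]
      J_in[OF T(2)] V_in cov_tensor_diff[OF form(1), of "[V]" 0 vf_zero vf_zero p]
      vf_zero_in_vector_fields[of A]
    by (simp add: vf_tuples_def vf_diff_def vf_zero_def)
  also have "\<dots> = - 2 * g [torsion D (J V) (K X), K Y] p"
    using dw[OF T(2)] torsion_cyclic[OF K_in[OF X] K_in[OF Y] J_in[OF V_in]] by simp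
  \<comment> \<open>The prefactor of \<open>twisted_deriv\<close> is -1, while the outer action on a
    2-form contributes +1, so the sign changes once.\<close>
  finally have 2: "twisted_deriv 1 K (form_act 1 L \<omega>) [X, Y] p
      = 2 * g [torsion D (J V) (K X), K Y] p"
    by (simp add: twisted_deriv_def form_act_def[of "Suc (Suc 0)"])
  show ?thesis
    using potential[of "[X, Y]" p] X Y 1 2 by (simp add: vf_tuples_def fundamental_form_def)
qed

text \<open>Skewness of \<open>K\<close> moves it from \<open>Y\<close> onto the torsion term; then
  nondegeneracy of \<open>g\<close> removes the arbitrary \<open>Y\<close>.\<close>

lemma J_eq_torsion:
  assumes X: "X \<in> vector_fields A"
  shows "J X = vf_diff (vf_diff vf_zero (K (torsion D (J V) (K X)))) (torsion D (J V) X)"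
proof -
  have T: "torsion D (J V) (K X) \<in> vector_fields A" "torsion D (J V) X \<in> vector_fields A"
    using X V_in by (auto intro: torsion_in J_in K_in)
  show ?thesis
  proof (rule metric_nondegenerate[OF J_in[OF X]])
    show "vf_diff (vf_diff vf_zero (K (torsion D (J V) (K X)))) (torsion D (J V) X) \<in> vector_fields A"
      using T by (auto intro!: diff_in K_in vf_zero_in_vector_fields)
    show "g [J X, Y] p =
        g [vf_diff (vf_diff vf_zero (K (torsion D (J V) (K X)))) (torsion D (J V) X), Y] p"
      if Y: "Y \<in> vector_fields A" for Y p
      using potential_torsion[OF X Y] isometry_skew[OF complex(2) K_isometry T(1) Y]
      by (simp add: metric_diff_left metric_zero_left T Y K_in diff_in vf_zero_in_vector_fields)
  qed
qed

section \<open>Lie derivatives of the three complex structures along \<open>J V\<close>\<close>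

lemma lie_JV_J: "X \<in> vector_fields A \<Longrightarrow> lie_endo (J V) J X = vf_zero"
  using lie_endo_along_image[OF atlas complex(1) V_in]
    lie_endo_parallel[OF V_in V_parallel endo(1) par(1)] V_torsion J_in endo_tensor_zero[OF endo(1)]
  by (simp add: vf_diff_def vf_zero_def)

text \<open>Applying \<open>K\<close> to \<open>J_eq_torsion\<close>, with \<open>K J = - L\<close>
  and \<open>K K = - 1\<close>, expresses \<open>L X\<close> as the commutator of \<open>K\<close>
  with the torsion endomorphism of \<open>J V\<close>, which \<open>lie_endo_parallel\<close>
  identifies as the Lie derivative.\<close>

lemma lie_JV_K:
  assumes X: "X \<in> vector_fields A"
  shows "lie_endo (J V) K X = L X"
proof -
  let ?TK = "torsion D (J V) (K X)" and ?T = "torsion D (J V) X"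
  have T: "?TK \<in> vector_fields A" "?T \<in> vector_fields A"
    using X V_in by (auto intro: torsion_in J_in K_in)
  have "vf_diff vf_zero (L X) = K (J X)"
    using KJ[OF X] by simp
  also have "\<dots> = vf_diff (vf_diff vf_zero (K (K ?TK))) (K ?T)"
    using endo_tensor_diff[OF endo(2)] T endo_tensor_zero[OF endo(2)]
    by (simp add: J_eq_torsion[OF X] K_in diff_in vf_zero_in_vector_fields)
  also have "\<dots> = vf_diff ?TK (K ?T)"
    using complex_structureD(2)[OF complex(2) T(1)] by (simp add: vf_diff_def vf_zero_def)
  finally have "vf_diff vf_zero (L X) p f = vf_diff ?TK (K ?T) p f" for p f
    by simp
  then have "L X p f = K ?T p f - ?TK p f" for p f
    by (simp add: vf_diff_def vf_zero_def algebra_simps)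
  then show ?thesis
    using lie_endo_parallel[OF J_in[OF V_in] JV_parallel endo(2) par(2) X]
    by (simp add: vf_diff_def fun_eq_iff)
qed

text \<open>In the Leibniz rule for \<open>L = J K\<close> only the term
  \<open>J (L X) = - K X\<close> survives.\<close>

lemma lie_JV_L:
  assumes X: "X \<in> vector_fields A"
  shows "lie_endo (J V) L X = vf_diff vf_zero (K X)"
proof -
  have "lie_endo (J V) L X = vf_add (lie_endo (J V) J (K X)) (J (lie_endo (J V) K X))"
    using endo(1,2) JK by (intro lie_endo_comp[OF atlas, where K = K] J_in V_in X) simp_all
  then show ?thesis
    using lie_JV_J[OF K_in[OF X]] lie_JV_K[OF X] JL[OF X]
    by (simp add: vf_add_def vf_zero_def)
qed

end


theorem corollary9:
  fixes A :: "('m::{t2_space, second_countable_topology}, 'e::euclidean_space) atlas"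
    and g :: "'m cov_field"
    and I :: "nat \<Rightarrow> 'm endo_field"
    and D :: "'m connection"
    and \<theta> :: "'m cov_field"
    and V :: "'m vector_field"
  assumes "hkt_manifold A g I"
    and "hkt_connection A g I D"
    and "diff_form A 1 \<theta>"
    and "potential_1_form A g I (\<lambda>Xs p. - 2 * \<theta> Xs p)"
    and "closed_form A 1 (\<lambda>Xs p. - 2 * \<theta> Xs p)"
    and "parallel_cov A D 1 (\<lambda>Xs p. - 2 * \<theta> Xs p)"
    and "V \<in> vector_fields A"
    and "\<forall>X\<in>vector_fields A. \<theta> [X] = g [V, X]"
  shows "\<forall>r\<in>{1, 2, 3}. \<forall>s\<in>{1, 2, 3}.
    (\<forall>Xs\<in>vf_tuples A 2. lie_cov V g Xs = (\<lambda>p. 0)) \<and>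
    (\<forall>Xs\<in>vf_tuples A 2. lie_cov (I r V) g Xs = (\<lambda>p. 0)) \<and>
    (\<forall>X\<in>vector_fields A.
       lie_endo (I r V) (I s) X = (\<lambda>p f. \<Sum>t\<in>{1, 2, 3}. levi_civita r s t * I t X p f))"
proof -
  let ?\<omega> = "\<lambda>Xs p. - 2 * \<theta> Xs p"
  interpret skew_torsion_connection A g D
    using assms(1,2) by unfold_locales
      (auto simp: hkt_manifold_def hyperhermitian_def hkt_connection_def)
  have hyper: "hyperhermitian A g I"
    using assms(1) by (simp add: hkt_manifold_def)
  have cs: "complex_structure A (I 1)" "complex_structure A (I 2)" "complex_structure A (I 3)"
    using hyper by (auto simp: hyperhermitian_def hypercomplex_def)
  have par: "parallel_endo A D (I 1)" "parallel_endo A D (I 2)" "parallel_endo A D (I 3)"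
    using assms(2) by (auto simp: hkt_connection_def)
  have iso: "\<And>X Y. X \<in> vector_fields A \<Longrightarrow> Y \<in> vector_fields A \<Longrightarrow> g [I 1 X, I 1 Y] = g [X, Y]"
    "\<And>X Y. X \<in> vector_fields A \<Longrightarrow> Y \<in> vector_fields A \<Longrightarrow> g [I 2 X, I 2 Y] = g [X, Y]"
    "\<And>X Y. X \<in> vector_fields A \<Longrightarrow> Y \<in> vector_fields A \<Longrightarrow> g [I 3 X, I 3 Y] = g [X, Y]"
    using hyper by (auto simp: hyperhermitian_def)
  have endo: "endo_tensor A (I 1)" "endo_tensor A (I 2)" "endo_tensor A (I 3)"
    using cs complex_structureD(1) by blast+
  note I_in = endo[THEN endo_tensor_in]
  note sq = complex_structureD(2)[OF cs(1)] complex_structureD(2)[OF cs(2)]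
  \<comment> \<open>A folded name for negation keeps double negations easy to cancel; it is unfolded
    again in \<open>quaternion\<close> to match the locale assumptions.\<close>
  define neg :: "'m vector_field \<Rightarrow> 'm vector_field" where "neg = vf_diff vf_zero"
  have neg_neg: "neg (neg X) = X" for X
    by (simp add: neg_def vf_diff_def vf_zero_def)
  have I_neg: "I 1 (neg X) = neg (I 1 X)" if "X \<in> vector_fields A" for X
    using endo_tensor_diff[OF endo(1) vf_zero_in_vector_fields that] endo_tensor_zero[OF endo(1)]
    by (simp add: neg_def)
  have I12: "I 1 (I 2 X) = I 3 X" and I21: "I 2 (I 1 X) = neg (I 3 X)"
    if "X \<in> vector_fields A" for X
  proof -
    have *: "I 1 (I 2 X) = I 3 X" "I 3 X = neg (I 2 (I 1 X))"
      using hyper that by (auto simp: hyperhermitian_def hypercomplex_def neg_def)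
    show "I 1 (I 2 X) = I 3 X" by fact
    show "I 2 (I 1 X) = neg (I 3 X)" by (simp add: *(2) neg_neg)
  qed
  \<comment> \<open>The definition of \<open>hypercomplex\<close> only fixes the products of
    \<open>I 1\<close> and \<open>I 2\<close>; the other four follow from these and the
    squares.\<close>
  have I13: "I 1 (I 3 X) = neg (I 2 X)" if "X \<in> vector_fields A" for X
    using I12[OF that] sq(1)[OF I_in(2)[OF that]] by (simp add: neg_def)
  have I32: "I 3 (I 2 X) = neg (I 1 X)" if "X \<in> vector_fields A" for X
    using I12[OF I_in(2)[OF that]] sq(2)[OF that] I_neg[OF that] by (simp add: neg_def)
  have I31: "I 3 (I 1 X) = I 2 X" if "X \<in> vector_fields A" for X
    using I12[OF I_in(1)[OF that]] I21[OF that] I_neg[OF I_in(3)[OF that]] I13[OF that] neg_neg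
    by simp
  have I23: "I 2 (I 3 X) = I 1 X" if "X \<in> vector_fields A" for X
    using I21[OF I_in(2)[OF that]] I12[OF that] I32[OF that] neg_neg by simp
  note quaternion = I12 I31 I23 I21[unfolded neg_def] I13[unfolded neg_def] I32[unfolded neg_def]
  have form: "cov_tensor A 1 ?\<omega>"
    using assms(4) by (simp add: potential_1_form_def diff_form_def)
  have dual: "?\<omega> [X] p = - 2 * g [V, X] p" if "X \<in> vector_fields A" for X p
    using assms(8) that by simp
  have V_parallel: "D X V = vf_zero" if "X \<in> vector_fields A" for X
    by (rule dual_of_parallel[OF assms(6,7) _ dual that]) simp
  have V_torsion: "torsion D V X = vf_zero" if "X \<in> vector_fields A" for X
    by (rule torsion_dual_of_closed[OF form assms(6,5,7) _ dual that]) simp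
  note pot = assms(4)[unfolded potential_1_form_def Let_def, THEN conjunct2, rule_format]
  note facts = cs par iso form assms(6,7) V_parallel V_torsion dual quaternion
    pot[THEN conjunct1] pot[THEN conjunct2, THEN conjunct1] pot[THEN conjunct2, THEN conjunct2]
  \<comment> \<open>The six products in \<open>quaternion\<close> cover the four needed for each
    cyclic permutation, and the three equations in \<open>pot\<close> are permuted in the same
    way.\<close>
  interpret P1: potential_triple A g D "I 1" "I 2" "I 3" ?\<omega> V
    by unfold_locales (rule facts; assumption)+
  interpret P2: potential_triple A g D "I 2" "I 3" "I 1" ?\<omega> V
    by unfold_locales (rule facts; assumption)+
  interpret P3: potential_triple A g D "I 3" "I 1" "I 2" ?\<omega> V
    by unfold_locales (rule facts; assumption)+
  have killing: "lie_cov V g Xs = (\<lambda>p. 0)" if "Xs \<in> vf_tuples A 2" for Xs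
    using parallel_imp_killing[OF assms(7) V_parallel that] .
  have killing_I: "lie_cov (I r V) g Xs = (\<lambda>p. 0)"
    if "r \<in> {1, 2, 3}" "Xs \<in> vf_tuples A 2" for r Xs
    using that(1) parallel_imp_killing[OF I_in(1)[OF assms(7)] P1.JV_parallel that(2)]
      parallel_imp_killing[OF I_in(2)[OF assms(7)] P2.JV_parallel that(2)]
      parallel_imp_killing[OF I_in(3)[OF assms(7)] P3.JV_parallel that(2)]
    by blast
  have lie_I: "lie_endo (I r V) (I s) X = (\<lambda>p f. \<Sum>t\<in>{1, 2, 3}. levi_civita r s t * I t X p f)"
    if r: "r \<in> {1, 2, 3}" and s: "s \<in> {1, 2, 3}" and X: "X \<in> vector_fields A" for r s X
  proof -
    note lie = P1.lie_JV_J[OF X] P1.lie_JV_K[OF X] P1.lie_JV_L[OF X]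
      P2.lie_JV_J[OF X] P2.lie_JV_K[OF X] P2.lie_JV_L[OF X]
      P3.lie_JV_J[OF X] P3.lie_JV_K[OF X] P3.lie_JV_L[OF X]
    show ?thesis
      using r s
      \<comment> \<open>Nine cases: \<open>P1\<close>, \<open>P2\<close>, \<open>P3\<close> handle
        \<open>r = 1, 2, 3\<close>, and their results for \<open>J\<close>, \<open>K\<close>,
        \<open>L\<close> match the Levi-Civita values 0, 1 and -1.\<close>
      by (elim insertE emptyE; hypsubst)
        (simp_all add: lie levi_civita_def vf_diff_def vf_zero_def del: One_nat_def)
  qed
  show ?thesis
    by (intro ballI conjI killing killing_I lie_I)
qed

end
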